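(* Let $\mathcal{A}$ be a unital $*$-algebra over $\mathbb{C}$ with unit $I$. Assume that $\mathcal{A}$ contains a nontrivial projection $P$ such that for every $X\in\mathcal{A}$: (i) $X\mathcal{A}P=0$ implies $X=0$, and (ii) $X\mathcal{A}(I-P)=0$ implies $X=0$. Then a (not necessarily additive or linear) map $\Phi:\mathcal{A}\rightarrow\mathcal{A}$ satisfies $$\Phi([A\bullet B, C]_{*})=[\Phi(A)\bullet B, C]_{*}+[A\bullet \Phi(B), C]_{*}+[A\bullet B, \Phi(C)]_{*}$$ for all $A,B,C\in\mathcal{A}$ if and only if $\Phi$ is an additive $*$-derivation.
   Context: For $A,B$ in a $*$-algebra $\mathcal{A}$ over $\mathbb{C}$, define $[A,B]_{*}=AB-BA^{*}$ and $A\bullet B=AB+BA^{*}$. Thus $[A\bullet B,C]_{*}=(A\bullet B)C-C(A\bullet B)^{*}$. A projection is an element $P$ with $P=P^{*}=P^{2}$; it is nontrivial if $P\neq 0$ and $P\neq I$. The notation $X\mathcal{A}P=0$ means $XAP=0$ for all $A\in\mathcal{A}$. An additive $*$-derivation on $\mathcal{A}$ is an additive map $\Phi:\mathcal{A}\to\mathcal{A}$ (no homogeneity over $\mathbb{C}$ is assumed) such that $\Phi(AB)=\Phi(A)B+A\Phi(B)$ for all $A,B\in\mathcal{A}$ and $\Phi(A^{*})=\Phi(A)^{*}$ for all $A\in\mathcal{A}$. *)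

theory Defs
  imports Complex_Main
begin

text \<open>The underlying associative unital ring comes from the type class \<open>ring_1\<close>, with unit \<open>1\<close>;
  the scalar action of the complex numbers and the involution are locale parameters. The class
  \<open>ring_1\<close> requires \<open>0 \<noteq> 1\<close>, which is automatic in an algebra with a nontrivial projection.\<close>

locale unital_star_algebra = vector_space scale
  for scale :: "complex \<Rightarrow> 'a::ring_1 \<Rightarrow> 'a" (infixr \<open>*s\<close> 75) +
  fixes star :: "'a \<Rightarrow> 'a"
  assumes scale_mult_left: "(c *s x) * y = c *s (x * y)"
    and scale_mult_right: "x * (c *s y) = c *s (x * y)"
    and star_star: "star (star x) = x"
    and star_add: "star (x + y) = star x + star y"
    and star_scale: "star (c *s x) = cnj c *s star x"
    and star_mult: "star (x * y) = star y * star x"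

definition skew_lie :: "('a::ring_1 \<Rightarrow> 'a) \<Rightarrow> 'a \<Rightarrow> 'a \<Rightarrow> 'a" where
  "skew_lie star A B = A * B - B * star A"

definition jordan_star :: "('a::ring_1 \<Rightarrow> 'a) \<Rightarrow> 'a \<Rightarrow> 'a \<Rightarrow> 'a" where
  "jordan_star star A B = A * B + B * star A"

definition nontrivial_projection :: "('a::ring_1 \<Rightarrow> 'a) \<Rightarrow> 'a \<Rightarrow> bool" where
  "nontrivial_projection star P \<longleftrightarrow> star P = P \<and> P\<^sup>2 = P \<and> P \<noteq> 0 \<and> P \<noteq> 1"

text \<open>No homogeneity over the complex numbers is required of a derivation.\<close>

definition additive_star_derivation :: "('a::ring_1 \<Rightarrow> 'a) \<Rightarrow> ('a \<Rightarrow> 'a) \<Rightarrow> bool" where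
  "additive_star_derivation star \<Phi> \<longleftrightarrow> additive \<Phi> \<and>
     (\<forall>A B. \<Phi> (A * B) = \<Phi> A * B + A * \<Phi> B) \<and> (\<forall>A. \<Phi> (star A) = star (\<Phi> A))"

end

theory Submission
  imports Defs
begin

text \<open>
Write \<open>A \<diamond> B = AB - BA\<^sup>*\<close> and \<open>A \<bullet> B = AB + BA\<^sup>*\<close>. That a derivation satisfies the triple
identity is a direct expansion; the content lies in the converse, where \<open>\<Phi>\<close> is not
known to be additive.

The triple product is split into its two brackets by feeding it central elements. Since
\<open>1/2 \<bullet> A = A\<close>, inserting \<open>1/2\<close> in the first slot gives
\<open>\<Phi>(A \<diamond> B) = h \<bullet> A \<diamond> B + \<Phi>(A) \<diamond> B + A \<diamond> \<Phi>(B)\<close> with \<open>h = \<Phi>(1/2)\<close>.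
Triple products that vanish identically force \<open>h\<close> to be central and self-adjoint
(\<open>star_h\<close>, \<open>h_central\<close>), so the error term is just \<open>2h(A \<diamond> B)\<close>, and the corrected map
\<open>\<Psi>(A) = \<Phi>(A) + 2hA\<close> satisfies the Leibniz rule for \<open>\<diamond>\<close>. It also commutes with
multiplication by \<open>\<i>\<close> (\<open>\<Psi>_i\<close>), and since \<open>(\<i>A) \<diamond> B = \<i>(A \<bullet> B)\<close> it satisfies the
Leibniz rule for \<open>\<bullet>\<close> as well.

Additivity of \<open>\<Psi>\<close> is measured by the defect \<open>\<Psi>(a + b) - \<Psi>(a) - \<Psi>(b)\<close>. The Leibniz rules
make bracketing with a fixed element commute with the defect: \<open>defect a b \<diamond> x\<close> is the defect
of \<open>a \<diamond> x\<close> and \<open>b \<diamond> x\<close>, and likewise for \<open>\<bullet>\<close> and on the other side. Hence a bracket that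
annihilates \<open>a\<close> or \<open>b\<close> annihilates their defect. Choosing brackets with \<open>P\<close>,
\<open>1 - P\<close> and off-diagonal elements shows that \<open>\<Psi>\<close> is additive across the four Peirce corners
(\<open>\<Psi>_corners\<close>), then within the off-diagonal ones (\<open>\<Psi>_off_diagonal\<close>), and from there within
the diagonal ones (\<open>\<Psi>_diagonal\<close>). The two annihilator conditions serve to kill a defect that
is known only to lie in a diagonal corner.

Once \<open>\<Psi>\<close> is additive, \<open>2AB = A \<diamond> B + A \<bullet> B\<close> makes it a derivation, and
\<open>\<Psi>(A \<bullet> 1) = \<Psi>(A) \<bullet> 1\<close> makes it commute with the involution. Then \<open>\<Psi>(1/2) = 0\<close>; but
\<open>\<Psi>(1/2) = h + 2h/2 = 2h\<close>, so \<open>h = 0\<close> and \<open>\<Phi> = \<Psi>\<close>.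
\<close>

section \<open>Arithmetic in a unital star-algebra\<close>

context unital_star_algebra
begin

abbreviation skew (infixl \<open>\<diamond>\<close> 70) where "A \<diamond> B \<equiv> skew_lie star A B"
abbreviation jordan (infixl \<open>\<bullet>\<close> 70) where "A \<bullet> B \<equiv> jordan_star star A B"

lemma sum_of_halves: "(1/2) *s x + (1/2) *s x = x"
  by (simp flip: scale_left_distrib)

lemma double_eq_0: "x + x = 0 \<Longrightarrow> x = (0 :: 'a)"
  using sum_of_halves[of x] by (simp flip: scale_right_distrib)

lemma star_zero [simp]: "star 0 = 0"
  using star_add[of 0 0] by simp

lemma star_minus: "star (- x) = - star x"
  using star_add[of x "- x"] by (simp add: eq_neg_iff_add_eq_0 add.commute)

lemma star_diff: "star (x - y) = star x - star y"
  using star_add[of x "- y"] by (simp add: star_minus)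

lemma star_one [simp]: "star 1 = 1"
  using star_mult[of "star 1" 1] by (simp add: star_star)

lemmas star_algebra_simps = algebra_simps scale_mult_left scale_mult_right
  star_star star_add star_diff star_minus star_scale star_mult

lemma skew_add_left: "(a + b) \<diamond> c = a \<diamond> c + b \<diamond> c"
  and skew_add_right: "c \<diamond> (a + b) = c \<diamond> a + c \<diamond> b"
  and jordan_add_left: "(a + b) \<bullet> c = a \<bullet> c + b \<bullet> c"
  and jordan_add_right: "c \<bullet> (a + b) = c \<bullet> a + c \<bullet> b"
  by (simp_all add: skew_lie_def jordan_star_def star_algebra_simps)

lemma skew_plus_jordan: "a \<diamond> b + a \<bullet> b = a * b + a * b"
  by (simp add: skew_lie_def jordan_star_def)

lemma skew_jordan_eq_0:
  assumes "a \<diamond> b = 0" and "a \<bullet> b = 0" shows "a * b = 0"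
  using double_eq_0[of "a * b"] skew_plus_jordan[of a b] assms by simp

lemma jordan_eq_skew: "a \<bullet> b = - \<i> *s ((\<i> *s a) \<diamond> b)"
  by (simp add: skew_lie_def jordan_star_def star_algebra_simps)

definition complementary_projections :: "'a \<Rightarrow> 'a \<Rightarrow> bool" where
  "complementary_projections e f \<longleftrightarrow> star e = e \<and> e * e = e \<and> e + f = 1"

text \<open>Equivalently, the algebra acts faithfully by left multiplication on its left ideal
  generated by \<open>e\<close>.\<close>

definition faithful :: "'a \<Rightarrow> bool" where
  "faithful e \<longleftrightarrow> (\<forall>x. (\<forall>a. x * a * e = 0) \<longrightarrow> x = 0)"

lemma complementary_projections_sym:
  assumes "complementary_projections e f" shows "complementary_projections f e"
proof -
  have f: "f = 1 - e" using assms by (auto simp: complementary_projections_def algebra_simps)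
  have "star e = e" "e * e = e" using assms
    by (simp_all add: complementary_projections_def)
  then show ?thesis
    by (simp add: complementary_projections_def f star_diff algebra_simps)
qed

lemma peirce_simps:
  assumes "complementary_projections e f"
  shows "star e = e" "star f = f" "e * e = e" "f * f = f" "e * f = 0" "f * e = 0"
    "e * (e * x) = e * x" "f * (f * x) = f * x" "e * (f * x) = 0" "f * (e * x) = 0"
proof -
  have f: "f = 1 - e" using assms by (auto simp: complementary_projections_def algebra_simps)
  show *: "star e = e" "star f = f" "e * e = e" "f * f = f" "e * f = 0" "f * e = 0"
    using assms by (simp_all add: complementary_projections_def f star_diff algebra_simps)
  show "e * (e * x) = e * x" "f * (f * x) = f * x" "e * (f * x) = 0" "f * (e * x) = 0"
    by (simp_all add: * flip: mult.assoc)
qed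

lemma peirce_sum:
  assumes "complementary_projections e f"
  shows "x * e + x * f = x" and "e * x + f * x = x"
  using assms by (simp_all add: complementary_projections_def flip: distrib_left distrib_right)

end

section \<open>Additivity of maps that derive both brackets\<close>

locale star_bracket_derivation = unital_star_algebra scale star
  for scale :: "complex \<Rightarrow> 'a::ring_1 \<Rightarrow> 'a" (infixr \<open>*s\<close> 75) and star :: "'a \<Rightarrow> 'a" +
  fixes \<Psi> :: "'a \<Rightarrow> 'a"
  assumes skew: "\<Psi> (A \<diamond> B) = \<Psi> A \<diamond> B + A \<diamond> \<Psi> B"
    and jordan: "\<Psi> (A \<bullet> B) = \<Psi> A \<bullet> B + A \<bullet> \<Psi> B"
begin

definition defect :: "'a \<Rightarrow> 'a \<Rightarrow> 'a" where
  "defect a b = \<Psi> (a + b) - \<Psi> a - \<Psi> b"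

lemma defect_eq_0_iff: "defect a b = 0 \<longleftrightarrow> \<Psi> (a + b) = \<Psi> a + \<Psi> b"
  by (auto simp: defect_def algebra_simps)

lemma \<Psi>_0: "\<Psi> 0 = 0"
  using skew[of 0 0] by (simp add: skew_lie_def)

lemma defect_0: "defect 0 b = 0" "defect a 0 = 0"
  by (simp_all add: defect_def \<Psi>_0)

text \<open>By the Leibniz rule, \<open>\<Psi>(a \<diamond> x) = \<Psi>(a) \<diamond> x + a \<diamond> \<Psi>(x)\<close>, where the second summand is additive
  in \<open>a\<close> and so cancels from the defect. The same holds in the three variants below.\<close>

lemma defect_skew_right: "defect a b \<diamond> x = defect (a \<diamond> x) (b \<diamond> x)"
proof -
  have "\<Psi> ((a + b) \<diamond> x) = \<Psi> (a + b) \<diamond> x + (a + b) \<diamond> \<Psi> x" by (rule skew)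
  then have "\<Psi> (a \<diamond> x + b \<diamond> x) = \<Psi> (a + b) \<diamond> x + (a + b) \<diamond> \<Psi> x"
    by (simp add: skew_add_left)
  then show ?thesis unfolding defect_def
    by (simp only: skew) (simp add: skew_lie_def star_algebra_simps)
qed

lemma defect_jordan_right: "defect a b \<bullet> x = defect (a \<bullet> x) (b \<bullet> x)"
proof -
  have "\<Psi> ((a + b) \<bullet> x) = \<Psi> (a + b) \<bullet> x + (a + b) \<bullet> \<Psi> x" by (rule jordan)
  then have "\<Psi> (a \<bullet> x + b \<bullet> x) = \<Psi> (a + b) \<bullet> x + (a + b) \<bullet> \<Psi> x"
    by (simp add: jordan_add_left)
  then show ?thesis unfolding defect_def
    by (simp only: jordan) (simp add: jordan_star_def star_algebra_simps)
qed

lemma defect_skew_left: "x \<diamond> defect a b = defect (x \<diamond> a) (x \<diamond> b)"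
proof -
  have "\<Psi> (x \<diamond> (a + b)) = \<Psi> x \<diamond> (a + b) + x \<diamond> \<Psi> (a + b)" by (rule skew)
  then have "\<Psi> (x \<diamond> a + x \<diamond> b) = \<Psi> x \<diamond> (a + b) + x \<diamond> \<Psi> (a + b)"
    by (simp add: skew_add_right)
  then show ?thesis unfolding defect_def
    by (simp only: skew) (simp add: skew_lie_def star_algebra_simps)
qed

lemma defect_jordan_left: "x \<bullet> defect a b = defect (x \<bullet> a) (x \<bullet> b)"
proof -
  have "\<Psi> (x \<bullet> (a + b)) = \<Psi> x \<bullet> (a + b) + x \<bullet> \<Psi> (a + b)" by (rule jordan)
  then have "\<Psi> (x \<bullet> a + x \<bullet> b) = \<Psi> x \<bullet> (a + b) + x \<bullet> \<Psi> (a + b)"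
    by (simp add: jordan_add_right)
  then show ?thesis unfolding defect_def
    by (simp only: jordan) (simp add: jordan_star_def star_algebra_simps)
qed

text \<open>The hypotheses make both brackets of \<open>a\<close> with \<open>x\<close> vanish, hence both brackets of the
  defect with \<open>x\<close>, whose sum is twice the product.\<close>

lemma defect_mult_eq_0:
  assumes "a * x = 0" "x * star a = 0"
  shows "defect a b * x = 0" "defect b a * x = 0"
proof -
  have "a \<diamond> x = 0" "a \<bullet> x = 0" using assms by (simp_all add: skew_lie_def jordan_star_def)
  then show "defect a b * x = 0" "defect b a * x = 0"
    by (simp_all add: skew_jordan_eq_0 defect_skew_right defect_jordan_right defect_0)
qed

lemma mult_defect_eq_0:
  assumes "x * a = 0" "a * star x = 0"
  shows "x * defect a b = 0"
proof -
  have "x \<diamond> a = 0" "x \<bullet> a = 0" using assms by (simp_all add: skew_lie_def jordan_star_def)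
  then show ?thesis
    by (simp add: skew_jordan_eq_0 defect_skew_left defect_jordan_left defect_0)
qed

text \<open>Right multiplication by \<open>f\<close> kills \<open>xe\<close> and right multiplication by \<open>e\<close> kills \<open>xf\<close>, so both
  kill the defect of \<open>xe\<close> and \<open>xf\<close>.\<close>

lemma \<Psi>_columns:
  assumes ef: "complementary_projections e f"
  shows "\<Psi> x = \<Psi> (x * e) + \<Psi> (x * f)"
proof -
  note [simp] = peirce_simps[OF ef]
  have "defect (x * e) (x * f) * e = 0" "defect (x * e) (x * f) * f = 0"
    by (rule defect_mult_eq_0; simp add: star_mult mult.assoc)+
  then have "defect (x * e) (x * f) = 0"
    using peirce_sum(1)[OF ef, of "defect (x * e) (x * f)"] by simp
  then show ?thesis by (simp add: defect_eq_0_iff peirce_sum[OF ef])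
qed

text \<open>For \<open>m\<close> in the \<open>e\<close>-corner, \<open>m \<diamond> (eyf) = myf\<close>, since \<open>eyf m\<^sup>* = 0\<close>; the further bracket with
  \<open>e\<close> leaves this unchanged. So the last hypothesis says that \<open>m y f = 0\<close> for all \<open>y\<close>, and
  \<open>f\<close> is faithful. The outer bracket matters when \<open>m\<close> is the defect of \<open>a\<close> and \<open>b\<close>: it can
  annihilate \<open>b \<diamond> (eyf)\<close> where that element is nonzero in the \<open>f\<close>-corner.\<close>

lemma corner_eq_0:
  assumes ef: "complementary_projections e f" and "faithful f"
    and "f * m = 0" and "m * f = 0" and "\<And>y. e \<diamond> (m \<diamond> (e * y * f)) = 0"
  shows "m = 0"
proof -
  note [simp] = peirce_simps[OF ef]
  have m: "m * e = m" "e * m = m"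
    using peirce_sum[OF ef, of m] assms by simp_all
  have m': "m * (e * z) = m * z" "e * (m * z) = m * z" for z
    using m by (simp_all flip: mult.assoc)
  have "f * star m = star (m * f)" by (simp add: star_mult)
  then have fm: "f * star m = 0" by (simp add: assms)
  have "m * y * f = 0" for y
    using assms(5)[of y] by (simp add: skew_lie_def mult.assoc fm m m')
  then show ?thesis using assms(2) by (auto simp: faithful_def)
qed

text \<open>The corner \<open>exe\<close> is annihilated by \<open>f\<close> on both sides, which puts the defect into the
  \<open>e\<close>-corner. There it vanishes because \<open>fxe \<diamond> (eyf)\<close> lies in the \<open>f\<close>-corner, which \<open>e\<close>
  annihilates.\<close>

lemma \<Psi>_column_rows:
  assumes ef: "complementary_projections e f" and "faithful f"
  shows "\<Psi> (x * e) = \<Psi> (e * x * e) + \<Psi> (f * x * e)"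
proof -
  note [simp] = peirce_simps[OF ef]
  let ?M = "defect (e * x * e) (f * x * e)"
  have "?M = 0"
  proof (rule corner_eq_0[OF assms])
    show "f * ?M = 0" by (rule mult_defect_eq_0) (simp_all add: mult.assoc)
    show "?M * f = 0" by (rule defect_mult_eq_0) (simp_all add: star_mult mult.assoc)
    show "e \<diamond> (?M \<diamond> (e * y * f)) = 0" for y
    proof -
      have "e \<diamond> ((f * x * e) \<diamond> (e * y * f)) = 0"
        by (simp add: skew_lie_def star_algebra_simps)
      then show ?thesis by (simp add: defect_skew_right defect_skew_left defect_0)
    qed
  qed
  then have "\<Psi> (e * x * e + f * x * e) = \<Psi> (e * x * e) + \<Psi> (f * x * e)"
    by (simp add: defect_eq_0_iff)
  then show ?thesis using peirce_sum(2)[OF ef, of "x * e"] by (simp add: mult.assoc)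
qed

lemma \<Psi>_corners:
  assumes ef: "complementary_projections e f" and "faithful e" "faithful f"
  shows "\<Psi> x = \<Psi> (e * x * e) + \<Psi> (f * x * e) + \<Psi> (e * x * f) + \<Psi> (f * x * f)"
  using \<Psi>_columns[OF ef, of x] \<Psi>_column_rows[OF ef assms(3), of x]
    \<Psi>_column_rows[OF complementary_projections_sym[OF ef] assms(2), of x]
  by (simp add: algebra_simps)

text \<open>The sum \<open>a + b\<close> of two elements of the \<open>e\<close>-\<open>f\<close> corner appears as a single corner of a bracket
  whose factors mix \<open>a\<close> and \<open>b\<close> with the projections:
  \<open>(e + a) \<diamond> (f + b) = (a + b) - a\<^sup>* - b a\<^sup>*\<close>. The Leibniz rule together with additivity
  across corners evaluates \<open>\<Psi>\<close> of the left side as a sum over the four brackets of summands,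
  of which \<open>e \<diamond> b = b\<close> and \<open>a \<diamond> f = a - a\<^sup>*\<close> contribute \<open>\<Psi>(b)\<close> and \<open>\<Psi>(a) + \<Psi>(-a\<^sup>*)\<close>;
  the remaining terms agree on both sides.\<close>

lemma \<Psi>_off_diagonal:
  assumes ef: "complementary_projections e f" and "faithful e" "faithful f"
  shows "defect (e * a * f) (e * b * f) = 0"
proof -
  note [simp] = peirce_simps[OF ef]
  note split = \<Psi>_corners[OF assms]
  let ?a = "e * a * f" and ?b = "e * b * f"
  have 1: "\<Psi> (e + ?a) = \<Psi> e + \<Psi> ?a"
    using split[of "e + ?a"] by (simp add: algebra_simps \<Psi>_0)
  have 2: "\<Psi> (f + ?b) = \<Psi> f + \<Psi> ?b"
    using split[of "f + ?b"] by (simp add: algebra_simps \<Psi>_0)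
  have 3: "\<Psi> ((e + ?a) \<diamond> (f + ?b)) = \<Psi> (?a + ?b) + \<Psi> (e \<diamond> f) + \<Psi> (- star ?a) + \<Psi> (?a \<diamond> ?b)"
    using split[of "(e + ?a) \<diamond> (f + ?b)"]
    by (simp add: skew_lie_def star_algebra_simps \<Psi>_0)
  have 4: "\<Psi> (?a \<diamond> f) = \<Psi> ?a + \<Psi> (- star ?a)"
    using split[of "?a \<diamond> f"]
    by (simp add: skew_lie_def star_algebra_simps \<Psi>_0)
  have 5: "e \<diamond> ?b = ?b"
    by (simp add: skew_lie_def star_algebra_simps)
  have "\<Psi> ((e + ?a) \<diamond> (f + ?b)) = (\<Psi> e + \<Psi> ?a) \<diamond> (f + ?b) + (e + ?a) \<diamond> (\<Psi> f + \<Psi> ?b)"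
    by (simp only: skew 1 2)
  also have "\<dots> = \<Psi> (e \<diamond> f) + \<Psi> (e \<diamond> ?b) + \<Psi> (?a \<diamond> f) + \<Psi> (?a \<diamond> ?b)"
    by (simp only: skew skew_add_left skew_add_right) (simp add: algebra_simps)
  finally have "\<Psi> (?a + ?b) = \<Psi> ?a + \<Psi> ?b"
    by (simp only: 3 4 5) (simp add: algebra_simps)
  then show ?thesis by (simp add: defect_eq_0_iff)
qed

text \<open>Bracketing with \<open>eyf\<close> on the right carries the \<open>e\<close>-corner into the \<open>e\<close>-\<open>f\<close> corner, where
  additivity is known.\<close>

lemma \<Psi>_diagonal:
  assumes ef: "complementary_projections e f" and "faithful e" "faithful f"
  shows "defect (e * a * e) (e * b * e) = 0"
proof (rule corner_eq_0[OF ef assms(3)])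
  note [simp] = peirce_simps[OF ef]
  let ?M = "defect (e * a * e) (e * b * e)"
  show "f * ?M = 0" by (rule mult_defect_eq_0) (simp_all add: mult.assoc)
  show "?M * f = 0" by (rule defect_mult_eq_0) (simp_all add: star_mult mult.assoc)
  show "e \<diamond> (?M \<diamond> (e * y * f)) = 0" for y
  proof -
    have "(e * c * e) \<diamond> (e * y * f) = e * (c * e * y) * f" for c
      by (simp add: skew_lie_def star_algebra_simps)
    then have "?M \<diamond> (e * y * f) = 0"
      by (simp only: defect_skew_right \<Psi>_off_diagonal[OF assms])
    then show ?thesis by (simp add: skew_lie_def)
  qed
qed

theorem additive_\<Psi>:
  assumes ef: "complementary_projections e f" and "faithful e" "faithful f"
  shows "additive \<Psi>"
proof
  fix a b
  note split = \<Psi>_corners[OF assms]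
  note fe = complementary_projections_sym[OF ef] assms(3,2)
  have "\<Psi> (e * (a + b) * e) = \<Psi> (e * a * e) + \<Psi> (e * b * e)"
    using \<Psi>_diagonal[OF assms, of a b] by (simp add: defect_eq_0_iff distrib_left distrib_right)
  moreover have "\<Psi> (f * (a + b) * f) = \<Psi> (f * a * f) + \<Psi> (f * b * f)"
    using \<Psi>_diagonal[OF fe, of a b] by (simp add: defect_eq_0_iff distrib_left distrib_right)
  moreover have "\<Psi> (e * (a + b) * f) = \<Psi> (e * a * f) + \<Psi> (e * b * f)"
    using \<Psi>_off_diagonal[OF assms, of a b]
    by (simp add: defect_eq_0_iff distrib_left distrib_right)
  moreover have "\<Psi> (f * (a + b) * e) = \<Psi> (f * a * e) + \<Psi> (f * b * e)"
    using \<Psi>_off_diagonal[OF fe, of a b]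
    by (simp add: defect_eq_0_iff distrib_left distrib_right)
  ultimately have "\<Psi> (a + b)
      = (\<Psi> (e * a * e) + \<Psi> (f * a * e) + \<Psi> (e * a * f) + \<Psi> (f * a * f))
      + (\<Psi> (e * b * e) + \<Psi> (f * b * e) + \<Psi> (e * b * f) + \<Psi> (f * b * f))"
    using split[of "a + b"] by (simp add: add_ac)
  then show "\<Psi> (a + b) = \<Psi> a + \<Psi> b"
    unfolding split[of a, symmetric] split[of b, symmetric] .
qed

theorem additive_star_derivation_\<Psi>:
  assumes "additive \<Psi>"
  shows "additive_star_derivation star \<Psi>"
proof -
  interpret additive \<Psi> by fact
  have mult: "\<Psi> (a * b) = \<Psi> a * b + a * \<Psi> b" for a b
  proof -
    have "\<Psi> (a * b + a * b) = \<Psi> (a \<diamond> b) + \<Psi> (a \<bullet> b)"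
      by (simp only: add flip: skew_plus_jordan)
    then have "\<Psi> (a * b) + \<Psi> (a * b) = \<Psi> (a \<diamond> b) + \<Psi> (a \<bullet> b)"
      by (simp only: add)
    then have "\<Psi> (a * b) - (\<Psi> a * b + a * \<Psi> b) + (\<Psi> (a * b) - (\<Psi> a * b + a * \<Psi> b)) = 0"
      by (simp add: skew jordan) (simp add: skew_lie_def jordan_star_def algebra_simps)
    from double_eq_0[OF this] show ?thesis by simp
  qed
  have one: "\<Psi> 1 = 0" using mult[of 1 1] by simp
  have "\<Psi> (star a) = star (\<Psi> a)" for a
    using jordan[of a 1] by (simp add: jordan_star_def one add)
  with mult assms show ?thesis by (simp add: additive_star_derivation_def)
qed

end

section \<open>From the triple identity to the brackets\<close>

locale star_triple_derivation = unital_star_algebra scale star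
  for scale :: "complex \<Rightarrow> 'a::ring_1 \<Rightarrow> 'a" (infixr \<open>*s\<close> 75) and star :: "'a \<Rightarrow> 'a" +
  fixes \<Phi> :: "'a \<Rightarrow> 'a"
  assumes triple: "\<Phi> (A \<bullet> B \<diamond> C) = \<Phi> A \<bullet> B \<diamond> C + A \<bullet> \<Phi> B \<diamond> C + A \<bullet> B \<diamond> \<Phi> C"
begin

lemma \<Phi>_0: "\<Phi> 0 = 0"
  using triple[of 0 0 0] by (simp add: skew_lie_def jordan_star_def)

definition h :: 'a where "h = \<Phi> ((1/2) *s 1)"

text \<open>For \<open>r = 1/2\<close> the product \<open>x \<bullet> r \<diamond> r\<close> is the commutator of \<open>(x + x\<^sup>*)/2\<close> with a scalar, so it
  vanishes for every \<open>x\<close>; the triple identity then yields a relation \<open>F(x) = 0\<close> that is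
  linear in \<open>x\<close> and \<open>x\<^sup>*\<close>. The combination \<open>F(x) - \<i>F(\<i>x)\<close> eliminates \<open>x\<^sup>*\<close>. What is left,
  \<open>x(h - h\<^sup>*) + (xh - hx) = 0\<close>, gives \<open>h = h\<^sup>*\<close> at \<open>x = 1\<close> and then centrality.\<close>

lemma star_h: "star h = h" and h_central: "h * a = a * h"
proof -
  let ?F = "\<lambda>x. x * h + h * star x - star h * star x - x * star h
      + (x + star x) * h - h * (x + star x)"
  have F: "?F x = 0" for x
  proof -
    let ?r = "(1/2) *s (1::'a)"
    have "y \<bullet> ?r \<diamond> ?r = 0" for y
      by (simp add: skew_lie_def jordan_star_def star_algebra_simps)
    then have "x \<bullet> h \<diamond> ?r + x \<bullet> ?r \<diamond> h = 0"
      using triple[of x ?r ?r] by (simp add: h_def \<Phi>_0)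
    moreover have "x \<bullet> h \<diamond> ?r + x \<bullet> ?r \<diamond> h = (1/2) *s ?F x"
      by (simp add: skew_lie_def jordan_star_def star_algebra_simps)
    ultimately show ?thesis by simp
  qed
  have *: "a * h - a * star h + (a * h - h * a) = 0" (is "?G = 0") for a
  proof -
    have "?G + ?G = ?F a - \<i> *s ?F (\<i> *s a)"
      by (simp add: star_algebra_simps)
    then have "?G + ?G = 0" by (simp only: F) simp
    then show ?thesis by (rule double_eq_0)
  qed
  show s: "star h = h" using *[of 1] by simp
  show "h * a = a * h" using *[of a] by (simp add: s)
qed

text \<open>Since \<open>(\<i>/2) \<bullet> x = 0\<close> for every \<open>x\<close>, the triple identity with \<open>\<i>/2\<close> in the first slot and
  \<open>1\<close> in the last shows that \<open>d \<bullet> b\<close> is self-adjoint for every \<open>b\<close>, where \<open>d = \<Phi>(\<i>/2)\<close>.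
  As \<open>d \<bullet> b\<close> is complex linear in \<open>b\<close>, it must vanish, which at \<open>b = 1\<close> says that \<open>d\<close>
  is skew and then that it is central.\<close>

lemma \<Phi>_half_i: "star (\<Phi> ((\<i>/2) *s 1)) = - \<Phi> ((\<i>/2) *s 1)" (is "star ?d = _")
  and \<Phi>_half_i_central: "\<Phi> ((\<i>/2) *s 1) * a = a * \<Phi> ((\<i>/2) *s 1)"
proof -
  have sym: "star (?d \<bullet> b) = ?d \<bullet> b" for b
  proof -
    have 0: "(\<i>/2) *s 1 \<bullet> x = 0" for x
      by (simp add: jordan_star_def star_algebra_simps)
    have "?d \<bullet> b \<diamond> 1 = 0"
      using triple[of "(\<i>/2) *s 1" b 1] by (simp add: 0 \<Phi>_0) (simp add: skew_lie_def \<Phi>_0)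
    then show ?thesis by (simp add: skew_lie_def)
  qed
  have *: "?d \<bullet> b = 0" for b
  proof -
    have "?d \<bullet> (\<i> *s b) = \<i> *s (?d \<bullet> b)"
      by (simp add: jordan_star_def star_algebra_simps)
    with sym[of "\<i> *s b"] have "- (\<i> *s (?d \<bullet> b)) = \<i> *s (?d \<bullet> b)"
      by (simp add: star_scale sym)
    then have "\<i> *s (?d \<bullet> b) + \<i> *s (?d \<bullet> b) = 0" by (metis ab_left_minus)
    from double_eq_0[OF this] show ?thesis by simp
  qed
  show s: "star ?d = - ?d" using *[of 1]
    by (simp add: jordan_star_def eq_neg_iff_add_eq_0 add.commute)
  show "?d * a = a * ?d" using *[of a] by (simp add: jordan_star_def s)
qed

text \<open>The summand \<open>2hx\<close> absorbs the error \<open>2h(A \<diamond> B)\<close> by which \<open>\<Phi>\<close> fails the Leibniz rule for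
  \<open>\<diamond>\<close>: it occurs once in \<open>\<Psi>(A \<diamond> B)\<close> but twice in \<open>\<Psi>(A) \<diamond> B + A \<diamond> \<Psi>(B)\<close>.\<close>

definition \<Psi> :: "'a \<Rightarrow> 'a" where "\<Psi> x = \<Phi> x + (h * x + h * x)"

lemma \<Psi>_skew: "\<Psi> (A \<diamond> B) = \<Psi> A \<diamond> B + A \<diamond> \<Psi> B"
proof -
  have half: "(1/2) *s 1 \<bullet> x = x" for x
    by (simp add: jordan_star_def star_algebra_simps sum_of_halves)
  have c: "x * (h * y) = h * (x * y)" for x y
    by (metis h_central mult.assoc)
  have "\<Phi> (A \<diamond> B) = h \<bullet> A \<diamond> B + \<Phi> A \<diamond> B + A \<diamond> \<Phi> B"
    using triple[of "(1/2) *s 1" A B] by (simp add: half h_def)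
  then show ?thesis
    by (simp add: \<Psi>_def) (simp add: skew_lie_def jordan_star_def star_algebra_simps star_h c
        h_central[of A, symmetric] h_central[of B, symmetric] h_central[of "star A", symmetric])
qed

text \<open>Because \<open>(\<i>/2) \<diamond> x = \<i>x\<close>, the Leibniz rule gives \<open>\<Psi>(\<i>x) = 2dx + \<i>\<Psi>(x)\<close> with
  \<open>d = \<Psi>(\<i>/2)\<close> central and skew. Four applications at \<open>x = 1\<close> return to \<open>\<Psi>(1)\<close>, and the accumulated
  multiple of \<open>d\<close> must be zero.\<close>

lemma \<Psi>_i: "\<Psi> (\<i> *s x) = \<i> *s \<Psi> x"
proof -
  define d where "d = \<Psi> ((\<i>/2) *s 1)"
  have d_eq: "d = \<Phi> ((\<i>/2) *s 1) + \<i> *s h"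
    by (simp add: d_def \<Psi>_def scale_mult_right flip: scale_left_distrib)
  have d: "star d = - d" "d * a = a * d" for a
    by (simp_all add: d_eq star_add star_scale star_h \<Phi>_half_i distrib_left distrib_right
        \<Phi>_half_i_central scale_mult_left scale_mult_right h_central)
  have i: "\<Psi> (\<i> *s x) = (d * x + d * x) + \<i> *s \<Psi> x" for x
  proof -
    have "((\<i>/2) *s 1) \<diamond> y = \<i> *s y" for y
      by (simp add: skew_lie_def scale_mult_left scale_mult_right star_scale
          flip: scale_left_distrib)
    moreover have "d \<diamond> x = d * x + d * x" using d by (simp add: skew_lie_def)
    ultimately show ?thesis using \<Psi>_skew[of "(\<i>/2) *s 1" x] by (simp add: d_def)
  qed
  have "\<Psi> 1 = \<Psi> (\<i> *s \<i> *s \<i> *s \<i> *s 1)" by simp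
  also have "\<dots> = \<Psi> 1 - \<i> *s (d + d + (d + d) + (d + d + (d + d)))"
    by (simp only: i) (simp add: star_algebra_simps)
  finally have "\<i> *s (d + d + (d + d) + (d + d + (d + d))) = 0" by simp
  then have "d = 0" by (auto dest!: double_eq_0)
  then show ?thesis using i[of x] by simp
qed

sublocale bracket: star_bracket_derivation scale star \<Psi>
proof unfold_locales
  show "\<Psi> (A \<diamond> B) = \<Psi> A \<diamond> B + A \<diamond> \<Psi> B" for A B by (rule \<Psi>_skew)
  have neg: "\<Psi> (- x) = - \<Psi> x" for x
    using \<Psi>_i[of "\<i> *s x"] by (simp add: \<Psi>_i)
  have "\<Psi> (A \<bullet> B) = - \<i> *s \<Psi> ((\<i> *s A) \<diamond> B)" for A B
    by (simp add: jordan_eq_skew neg \<Psi>_i)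
  then show "\<Psi> (A \<bullet> B) = \<Psi> A \<bullet> B + A \<bullet> \<Psi> B" for A B
    by (simp add: \<Psi>_skew \<Psi>_i jordan_eq_skew scale_right_distrib)
qed

theorem additive_star_derivation_\<Phi>:
  assumes "complementary_projections e f" "faithful e" "faithful f"
  shows "additive_star_derivation star \<Phi>"
proof -
  have add: "additive \<Psi>" by (rule bracket.additive_\<Psi>[OF assms])
  then have der: "additive_star_derivation star \<Psi>"
    by (rule bracket.additive_star_derivation_\<Psi>)
  have "\<Psi> 1 = \<Psi> 1 + \<Psi> 1"
    using der unfolding additive_star_derivation_def by (metis mult_1 mult_1_right)
  then have "\<Psi> 1 = 0" by simp
  moreover have "\<Psi> 1 = \<Psi> ((1/2) *s 1) + \<Psi> ((1/2) *s 1)"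
    using additive.add[OF add, of "(1/2) *s 1" "(1/2) *s 1"] by (simp only: sum_of_halves)
  moreover have "\<Psi> ((1/2) *s 1) = h + h"
    by (simp add: \<Psi>_def scale_mult_right sum_of_halves flip: h_def)
  ultimately have "h = 0" by (auto dest!: double_eq_0)
  then have "\<Psi> = \<Phi>" by (auto simp: \<Psi>_def)
  with der show ?thesis by simp
qed

end

section \<open>The characterization\<close>

lemma (in unital_star_algebra) derivation_triple:
  assumes "additive_star_derivation star \<Phi>"
  shows "\<Phi> (A \<bullet> B \<diamond> C) = \<Phi> A \<bullet> B \<diamond> C + A \<bullet> \<Phi> B \<diamond> C + A \<bullet> B \<diamond> \<Phi> C"
proof -
  interpret additive \<Phi> using assms by (simp add: additive_star_derivation_def)
  have der: "\<Phi> (A * B) = \<Phi> A * B + A * \<Phi> B" "\<Phi> (star A) = star (\<Phi> A)" for A B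
    using assms by (simp_all add: additive_star_derivation_def)
  show ?thesis
    unfolding skew_lie_def jordan_star_def add diff der star_add star_mult
    by (simp add: algebra_simps)
qed

theorem theorem2p1:
  fixes scale :: "complex \<Rightarrow> 'a::ring_1 \<Rightarrow> 'a"
    and star :: "'a \<Rightarrow> 'a"
    and P :: 'a
    and \<Phi> :: "'a \<Rightarrow> 'a"
  assumes "unital_star_algebra scale star"
    and "nontrivial_projection star P"
    and "\<And>X. (\<And>A. X * A * P = 0) \<Longrightarrow> X = 0"
    and "\<And>X. (\<And>A. X * A * (1 - P) = 0) \<Longrightarrow> X = 0"
  shows "(\<forall>A B C.
            \<Phi> (skew_lie star (jordan_star star A B) C) =
              skew_lie star (jordan_star star (\<Phi> A) B) C
            + skew_lie star (jordan_star star A (\<Phi> B)) C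
            + skew_lie star (jordan_star star A B) (\<Phi> C))
         \<longleftrightarrow> additive_star_derivation star \<Phi>"
    (is "?triple \<longleftrightarrow> ?derivation")
proof
  interpret unital_star_algebra scale star by fact
  show ?triple if ?derivation
    by (intro allI derivation_triple that)
  show ?derivation if ?triple
  proof -
    interpret star_triple_derivation scale star \<Phi>
      using that by unfold_locales blast
    have "complementary_projections P (1 - P)"
      using assms(2)
      by (simp add: complementary_projections_def nontrivial_projection_def power2_eq_square)
    moreover have "faithful P" "faithful (1 - P)"
      unfolding faithful_def using assms(3,4) by blast+
    ultimately show ?thesis by (rule additive_star_derivation_\<Phi>)
  qed
qed

end
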